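(* Let $(X,\mu)$ and $(Y,\nu)$ be strong generalized topological spaces and let $f:(X,\mu)\to(Y,\nu)$ be a surjective mapping. Consider the following conditions. (1) $f$ is a $g$-open mapping. (2) $f$ is a $g$-closed mapping. (3) $f$ is a $g$-pseudo-open mapping. (4) $f$ is a $g$-quotient mapping. Then (1) $\Rightarrow$ (3) $\Rightarrow$ (4) and (2) $\Rightarrow$ (3).
   Context: A generalized topological space is a pair $(X,\mu)$ where $X$ is a set and $\mu$ is a family of subsets of $X$ such that $\emptyset\in\mu$ and any union of elements of $\mu$ belongs to $\mu$ (intersections are not required to belong to $\mu$). It is strong if $X\in\mu$. A set $B\subseteq X$ is $\mu$-open if $B\in\mu$, and $\mu$-closed if $X\setminus B\in\mu$. The interior $I(B)$ is the union of all $\mu$-open subsets of $B$ (analogously in $(Y,\nu)$). No continuity of $f$ is assumed. The mapping $f$ is: $g$-open if $f(U)\in\nu$ for each $U\in\mu$; $g$-closed if $f(F)$ is a $\nu$-closed subset of $Y$ for each $\mu$-closed subset $F$ of $X$; $g$-pseudo-open if for each $y\in Y$ and each $U\in\mu$ with $f^{-1}(y)\subseteq U$ (where $f^{-1}(y)=f^{-1}(\{y\})$), one has $y\in I(f(U))$; $g$-quotient if for each $V\subseteq Y$, $f^{-1}(V)\in\mu$ implies $V\in\nu$. *)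

theory Defs
  imports Main
begin

text \<open>
  A generalized topological space is represented by an explicit carrier \<open>X\<close> together with the
  family \<open>\<mu>\<close> of its open sets. A mapping between carriers \<open>X\<close> and \<open>Y\<close> is a total HOL function of
  which only the values on \<open>X\<close> are used; accordingly, the preimage of \<open>V\<close> is \<open>f -` V \<inter> X\<close>.
\<close>

definition gen_topology_on :: "'a set \<Rightarrow> 'a set set \<Rightarrow> bool" where
  "gen_topology_on X \<mu> \<longleftrightarrow>
     \<mu> \<subseteq> Pow X \<and> {} \<in> \<mu> \<and> (\<forall>\<U>. \<U> \<subseteq> \<mu> \<longrightarrow> \<Union>\<U> \<in> \<mu>)"

definition strong_gen_topology_on :: "'a set \<Rightarrow> 'a set set \<Rightarrow> bool" where
  "strong_gen_topology_on X \<mu> \<longleftrightarrow> gen_topology_on X \<mu> \<and> X \<in> \<mu>"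

definition g_closedin :: "'a set \<Rightarrow> 'a set set \<Rightarrow> 'a set \<Rightarrow> bool" where
  "g_closedin X \<mu> B \<longleftrightarrow> B \<subseteq> X \<and> X - B \<in> \<mu>"

definition g_interior :: "'a set set \<Rightarrow> 'a set \<Rightarrow> 'a set" where
  "g_interior \<mu> B = \<Union>{U \<in> \<mu>. U \<subseteq> B}"

definition g_open_map :: "'a set set \<Rightarrow> 'b set set \<Rightarrow> ('a \<Rightarrow> 'b) \<Rightarrow> bool" where
  "g_open_map \<mu> \<nu> f \<longleftrightarrow> (\<forall>U\<in>\<mu>. f ` U \<in> \<nu>)"

definition g_closed_map ::
    "'a set \<Rightarrow> 'a set set \<Rightarrow> 'b set \<Rightarrow> 'b set set \<Rightarrow> ('a \<Rightarrow> 'b) \<Rightarrow> bool" where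
  "g_closed_map X \<mu> Y \<nu> f \<longleftrightarrow> (\<forall>F. g_closedin X \<mu> F \<longrightarrow> g_closedin Y \<nu> (f ` F))"

definition g_pseudo_open_map ::
    "'a set \<Rightarrow> 'a set set \<Rightarrow> 'b set \<Rightarrow> 'b set set \<Rightarrow> ('a \<Rightarrow> 'b) \<Rightarrow> bool" where
  "g_pseudo_open_map X \<mu> Y \<nu> f \<longleftrightarrow>
     (\<forall>y\<in>Y. \<forall>U\<in>\<mu>. f -` {y} \<inter> X \<subseteq> U \<longrightarrow> y \<in> g_interior \<nu> (f ` U))"

definition g_quotient_map ::
    "'a set \<Rightarrow> 'a set set \<Rightarrow> 'b set \<Rightarrow> 'b set set \<Rightarrow> ('a \<Rightarrow> 'b) \<Rightarrow> bool" where
  "g_quotient_map X \<mu> Y \<nu> f \<longleftrightarrow> (\<forall>V. V \<subseteq> Y \<longrightarrow> f -` V \<inter> X \<in> \<mu> \<longrightarrow> V \<in> \<nu>)"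

end

theory Submission
  imports Defs
begin

text \<open>
  Pseudo-openness asks that \<open>f ` U\<close> be a neighbourhood of \<open>y\<close> whenever the open set \<open>U\<close> contains
  the whole fibre over \<open>y\<close>, that is, that some open set lies between \<open>{y}\<close> and \<open>f ` U\<close>. An open map
  offers \<open>f ` U\<close> itself, which contains \<open>y\<close> because surjectivity makes the fibre nonempty. A closed map offers
  \<open>Y - f ` (X - U)\<close>, the set of those points whose entire fibre lies in \<open>U\<close>; surjectivity puts it
  inside \<open>f ` U\<close>. As for quotients, if \<open>f -` V \<inter> X\<close> is open, it contains the fibre over each point of
  \<open>V\<close>, so pseudo-openness makes \<open>V\<close> a neighbourhood of each of its points; a set
  with that property is a union of open sets, hence open.
\<close>

lemma g_interiorI:
  assumes "W \<in> \<mu>" "y \<in> W" "W \<subseteq> B"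
  shows "y \<in> g_interior \<mu> B"
  using assms unfolding g_interior_def by auto

lemma open_if_subset_g_interior:
  assumes "gen_topology_on X \<mu>" "B \<subseteq> g_interior \<mu> B"
  shows "B \<in> \<mu>"
proof -
  have "g_interior \<mu> B \<in> \<mu>"
    using assms(1) unfolding gen_topology_on_def g_interior_def by simp
  moreover have "g_interior \<mu> B \<subseteq> B"
    unfolding g_interior_def by auto
  ultimately show ?thesis using assms(2) by (simp add: subset_antisym)
qed

lemma g_open_map_imp_pseudo_open:
  assumes surj: "f ` X = Y" and op: "g_open_map \<mu> \<nu> f"
  shows "g_pseudo_open_map X \<mu> Y \<nu> f"
  unfolding g_pseudo_open_map_def
proof (intro ballI impI)
  fix y U assume "y \<in> Y" "U \<in> \<mu>" and fibre: "f -` {y} \<inter> X \<subseteq> U"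
  then have "y \<in> f ` U" using surj by blast
  moreover have "f ` U \<in> \<nu>" using op \<open>U \<in> \<mu>\<close> unfolding g_open_map_def by simp
  ultimately show "y \<in> g_interior \<nu> (f ` U)" by (simp add: g_interiorI)
qed

text \<open>
  Since \<open>f\<close> need not be injective, \<open>f ` U\<close> can be larger than the complement of \<open>f ` (X - U)\<close> and
  need not be open; the smaller set is the open witness, and \<open>y\<close> lies in it exactly because its
  whole fibre, not just one point of it, lies in \<open>U\<close>.
\<close>

lemma g_closed_map_imp_pseudo_open:
  assumes top: "gen_topology_on X \<mu>" and surj: "f ` X = Y"
    and cl: "g_closed_map X \<mu> Y \<nu> f"
  shows "g_pseudo_open_map X \<mu> Y \<nu> f"
  unfolding g_pseudo_open_map_def
proof (intro ballI impI)
  fix y U assume y: "y \<in> Y" and U: "U \<in> \<mu>" and fibre: "f -` {y} \<inter> X \<subseteq> U"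
  have "U \<subseteq> X" using top U unfolding gen_topology_on_def by auto
  then have "X - (X - U) = U" by blast
  then have "g_closedin X \<mu> (X - U)" using U unfolding g_closedin_def by simp
  then have "Y - f ` (X - U) \<in> \<nu>"
    using cl unfolding g_closed_map_def g_closedin_def by simp
  moreover have "y \<in> Y - f ` (X - U)" using y fibre by blast
  moreover have "Y - f ` (X - U) \<subseteq> f ` U" using surj by blast
  ultimately show "y \<in> g_interior \<nu> (f ` U)" by (rule g_interiorI)
qed

text \<open>
  The full preimage of \<open>V\<close> is saturated: it contains the fibre over each of its image points, so a
  single open set serves in the pseudo-openness condition for all points of \<open>V\<close> at once.
\<close>

lemma g_pseudo_open_map_imp_quotient:
  assumes top: "gen_topology_on Y \<nu>" and surj: "f ` X = Y"
    and po: "g_pseudo_open_map X \<mu> Y \<nu> f"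
  shows "g_quotient_map X \<mu> Y \<nu> f"
  unfolding g_quotient_map_def
proof (intro allI impI)
  fix V assume V: "V \<subseteq> Y" and pre: "f -` V \<inter> X \<in> \<mu>"
  have image: "f ` (f -` V \<inter> X) = V" using V surj by blast
  have "V \<subseteq> g_interior \<nu> V"
  proof
    fix y assume "y \<in> V"
    then have "y \<in> Y" and "f -` {y} \<inter> X \<subseteq> f -` V \<inter> X" using V by auto
    then have "y \<in> g_interior \<nu> (f ` (f -` V \<inter> X))"
      using po pre unfolding g_pseudo_open_map_def by simp
    then show "y \<in> g_interior \<nu> V" by (simp only: image)
  qed
  with top show "V \<in> \<nu>" by (rule open_if_subset_g_interior)
qed

theorem theorem5:
  fixes X :: "'a set" and \<mu> :: "'a set set"
    and Y :: "'b set" and \<nu> :: "'b set set"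
    and f :: "'a \<Rightarrow> 'b"
  assumes "strong_gen_topology_on X \<mu>"
    and "strong_gen_topology_on Y \<nu>"
    and "f ` X = Y"
  shows "(g_open_map \<mu> \<nu> f \<longrightarrow> g_pseudo_open_map X \<mu> Y \<nu> f) \<and>
         (g_pseudo_open_map X \<mu> Y \<nu> f \<longrightarrow> g_quotient_map X \<mu> Y \<nu> f) \<and>
         (g_closed_map X \<mu> Y \<nu> f \<longrightarrow> g_pseudo_open_map X \<mu> Y \<nu> f)"
proof (intro conjI impI)
  have X: "gen_topology_on X \<mu>" and Y: "gen_topology_on Y \<nu>"
    using assms(1,2) unfolding strong_gen_topology_on_def by simp_all
  show "g_pseudo_open_map X \<mu> Y \<nu> f" if "g_open_map \<mu> \<nu> f"
    using assms(3) that by (rule g_open_map_imp_pseudo_open)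
  show "g_quotient_map X \<mu> Y \<nu> f" if "g_pseudo_open_map X \<mu> Y \<nu> f"
    using Y assms(3) that by (rule g_pseudo_open_map_imp_quotient)
  show "g_pseudo_open_map X \<mu> Y \<nu> f" if "g_closed_map X \<mu> Y \<nu> f"
    using X assms(3) that by (rule g_closed_map_imp_pseudo_open)
qed

end
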